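(* Let $X$ be an Archimedean vector lattice and $Y$ a sublattice of $X$. The following are equivalent: (1) $Y$ is regular in $X$; (2) for any net $(y_\alpha)$ in $Y$, $y_\alpha\xrightarrow{\rm uo}0$ in $Y$ implies $y_\alpha\xrightarrow{\rm uo}0$ in $X$; (3) for any net $(y_\alpha)$ in $Y$, $y_\alpha\xrightarrow{\rm uo}0$ in $Y$ if and only if $y_\alpha\xrightarrow{\rm uo}0$ in $X$.
   Context: All vector lattices are real and Archimedean. A sublattice $Y$ of $X$ is regular if for every subset $A$ of $Y$ whose infimum exists in $Y$, the infimum of $A$ exists in $X$ and equals the infimum in $Y$. A net $(x_\alpha)_{\alpha\in\Gamma}$ in a vector lattice $Z$ converges in order to $x\in Z$ ($x_\alpha\xrightarrow{\rm o}x$) if there is a net $(a_\gamma)_{\gamma\in\Lambda}$ in $Z$ (possibly over a different index set) with $a_\gamma\downarrow 0$ in $Z$ such that for every $\gamma\in\Lambda$ there is $\alpha_0\in\Gamma$ with $|x_\alpha-x|\le a_\gamma$ for all $\alpha\ge\alpha_0$. The net uo-converges to $x$ in $Z$ ($x_\alpha\xrightarrow{\rm uo}x$) if $|x_\alpha-x|\wedge z\xrightarrow{\rm o}0$ in $Z$ for every $z\in Z_+$. *)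

theory Defs
  imports Complex_Main "HOL-Library.Lattice_Algebras" "HOL-Library.Lub_Glb"
begin

text \<open>The absolute value is the one of lattice-ordered groups, \<open>\<bar>x\<bar> = sup x (- x)\<close>.\<close>

class vector_lattice = ordered_real_vector + lattice_ab_group_add_abs

class archimedean_vector_lattice = vector_lattice +
  assumes archimedean: "0 \<le> x \<Longrightarrow> (\<And>n::nat. real n *\<^sub>R x \<le> y) \<Longrightarrow> x = 0"

instance real :: archimedean_vector_lattice
proof
  fix x y :: real
  assume x: "0 \<le> x" and le: "\<And>n::nat. real n *\<^sub>R x \<le> y"
  show "x = 0"
  proof (rule ccontr)
    assume "x \<noteq> 0"
    with x obtain n :: nat where "y < real n * x"
      using ex_less_of_nat_mult[of x y] by auto
    with le[of n] show False by simp
  qed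
qed

definition sublattice :: "'a::vector_lattice set \<Rightarrow> bool" where
  "sublattice Y \<longleftrightarrow> subspace Y \<and> (\<forall>x\<in>Y. \<forall>y\<in>Y. sup x y \<in> Y \<and> inf x y \<in> Y)"

text \<open>The infimum of \<open>A\<close> computed in \<open>Y\<close> is \<^const>\<open>isGlb\<close> \<open>Y A\<close>. As usual for vector lattices,
  infima are those of nonempty sets: otherwise \<open>A = {}\<close>, which has the infimum \<open>0\<close> in \<open>{0}\<close>
  and no infimum in a nonzero vector lattice, would make \<open>{0}\<close> non-regular.\<close>

definition regular :: "'a::vector_lattice set \<Rightarrow> bool" where
  "regular Y \<longleftrightarrow> (\<forall>A m. A \<noteq> {} \<and> A \<subseteq> Y \<and> isGlb Y A m \<longrightarrow> isGlb UNIV A m)"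

text \<open>A net consists of a nonempty index set \<open>I\<close>, a preorder \<open>r\<close> on it (\<open>r i j\<close> meaning that
  \<open>j\<close> comes after \<open>i\<close>) that directs it upwards, and a family on \<open>I\<close>.\<close>

definition directed_set :: "'i set \<Rightarrow> ('i \<Rightarrow> 'i \<Rightarrow> bool) \<Rightarrow> bool" where
  "directed_set I r \<longleftrightarrow> I \<noteq> {} \<and> reflp_on I r \<and> transp_on I r \<and>
     (\<forall>i\<in>I. \<forall>j\<in>I. \<exists>k\<in>I. r i k \<and> r j k)"

definition net_in :: "'a set \<Rightarrow> 'i set \<Rightarrow> ('i \<Rightarrow> 'i \<Rightarrow> bool) \<Rightarrow> ('i \<Rightarrow> 'a) \<Rightarrow> bool" where
  "net_in Z I r x \<longleftrightarrow> directed_set I r \<and> (\<forall>i\<in>I. x i \<in> Z)"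

definition decreases_to_zero ::
  "'a::vector_lattice set \<Rightarrow> 'i set \<Rightarrow> ('i \<Rightarrow> 'i \<Rightarrow> bool) \<Rightarrow> ('i \<Rightarrow> 'a) \<Rightarrow> bool" where
  "decreases_to_zero Z I r a \<longleftrightarrow> net_in Z I r a \<and>
     (\<forall>i\<in>I. \<forall>j\<in>I. r i j \<longrightarrow> a j \<le> a i) \<and> isGlb Z (a ` I) 0"

text \<open>Convergence in the vector lattice carried by \<open>Z\<close>. The dominating net may be indexed by any
  directed subset of the type \<open>'a\<close> itself; by \<open>order_convI\<close> below, allowing index sets from other
  types would not give a weaker notion.\<close>

definition order_conv ::
  "'a::vector_lattice set \<Rightarrow> 'i set \<Rightarrow> ('i \<Rightarrow> 'i \<Rightarrow> bool) \<Rightarrow> ('i \<Rightarrow> 'a) \<Rightarrow> 'a \<Rightarrow> bool" where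
  "order_conv Z I r x l \<longleftrightarrow> l \<in> Z \<and>
     (\<exists>(L :: 'a set) s a. decreases_to_zero Z L s a \<and>
       (\<forall>g\<in>L. \<exists>i0\<in>I. \<forall>i\<in>I. r i0 i \<longrightarrow> \<bar>x i - l\<bar> \<le> a g))"

definition uo_conv ::
  "'a::vector_lattice set \<Rightarrow> 'i set \<Rightarrow> ('i \<Rightarrow> 'i \<Rightarrow> bool) \<Rightarrow> ('i \<Rightarrow> 'a) \<Rightarrow> 'a \<Rightarrow> bool" where
  "uo_conv Z I r x l \<longleftrightarrow> l \<in> Z \<and>
     (\<forall>z\<in>Z. 0 \<le> z \<longrightarrow> order_conv Z I r (\<lambda>i. inf \<bar>x i - l\<bar> z) 0)"

lemma order_convI:
  fixes a :: "'j \<Rightarrow> 'a::vector_lattice" and L :: "'j set"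
  assumes l: "l \<in> Z" and a: "decreases_to_zero Z L s a"
    and dom: "\<And>g. g \<in> L \<Longrightarrow> \<exists>i0\<in>I. \<forall>i\<in>I. r i0 i \<longrightarrow> \<bar>x i - l\<bar> \<le> a g"
  shows "order_conv Z I r x l"
proof -
  have "directed_set (a ` L) (\<lambda>u v. v \<le> u)"
    unfolding directed_set_def
  proof (intro conjI ballI)
    show "a ` L \<noteq> {}"
      using a by (simp add: decreases_to_zero_def net_in_def directed_set_def)
    show "reflp_on (a ` L) (\<lambda>u v. v \<le> u)" by (simp add: reflp_on_def)
    show "transp_on (a ` L) (\<lambda>u v. v \<le> u)" by (auto intro: transp_onI)
    fix u v assume "u \<in> a ` L" "v \<in> a ` L"
    then obtain g h where gh: "g \<in> L" "h \<in> L" "u = a g" "v = a h" by auto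
    then obtain k where "k \<in> L" "s g k" "s h k"
      using a unfolding decreases_to_zero_def net_in_def directed_set_def by blast
    with gh show "\<exists>k\<in>a ` L. k \<le> u \<and> k \<le> v"
      using a by (auto simp: decreases_to_zero_def)
  qed
  then have "decreases_to_zero Z (a ` L) (\<lambda>u v. v \<le> u) id"
    using a by (auto simp: decreases_to_zero_def net_in_def)
  moreover have "\<forall>g\<in>a ` L. \<exists>i0\<in>I. \<forall>i\<in>I. r i0 i \<longrightarrow> \<bar>x i - l\<bar> \<le> id g"
    using dom by simp
  ultimately show ?thesis
    unfolding order_conv_def using l by blast
qed

text \<open>Index sets may be relabelled, so quantifying over nets indexed in one type covers all nets
  indexed in types that embed into it.\<close>

definition transport :: "('i \<Rightarrow> 'k) \<Rightarrow> 'i set \<Rightarrow> ('i \<Rightarrow> 'i \<Rightarrow> bool) \<Rightarrow> 'k \<Rightarrow> 'k \<Rightarrow> bool" where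
  "transport h I r = (\<lambda>k m. r (inv_into I h k) (inv_into I h m))"

lemma net_in_reindex:
  assumes "inj_on h I"
  shows "net_in Z (h ` I) (transport h I r) (x \<circ> inv_into I h) \<longleftrightarrow> net_in Z I r x"
  using assms
  by (simp add: net_in_def directed_set_def transport_def reflp_on_def transp_on_def)

lemma uo_conv_reindex:
  assumes "inj_on h I"
  shows "uo_conv Z (h ` I) (transport h I r) (x \<circ> inv_into I h) l \<longleftrightarrow> uo_conv Z I r x l"
  using assms by (simp add: uo_conv_def order_conv_def transport_def)

end

theory Submission
  imports Defs
begin

text \<open>A net converges in order to \<open>0\<close> iff the set of its eventual bounds has infimum \<open>0\<close>, so
  everything reduces to lower bounds \<open>w \<ge> 0\<close> of eventual bounds. Let \<open>Y\<close> be regular.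
  If the net uo-converges to \<open>0\<close> in \<open>Y\<close> and \<open>w\<close> is below all eventual bounds of
  \<open>\<bar>y\<^sub>i\<bar> \<and> x\<close> in \<open>X\<close>, then \<open>w \<le> x - x \<and> z\<close> for all \<open>z \<in> Y\<^sub>+\<close>, which makes \<open>w\<close> disjoint
  from \<open>Y\<close>; hence whenever \<open>n w \<le> x\<close>, \<open>x - n w\<close> is still a bound, so \<open>(n + 1) w \<le> x\<close>, and
  \<open>w = 0\<close> by the Archimedean property. For the converse, a bounded tail \<open>A\<close> of the net has
  \<open>inf (U - A) = 0\<close> in \<open>Y\<close>, \<open>U\<close> being its set of upper bounds in \<open>Y\<close>; by regularity the same holds
  in \<open>X\<close>, so upper bounds in \<open>X\<close> dominate whatever is below \<open>U\<close>. Finally, if \<open>A\<close> has infimum \<open>m\<close> in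
  \<open>Y\<close>, the elements of \<open>Y\<close> above all lower bounds of \<open>A\<close> in \<open>X\<close> form a net decreasing to \<open>m\<close> in \<open>Y\<close>,
  and its uo-convergence in \<open>X\<close> forces every such lower bound to be \<open>\<le> m\<close>.\<close>

section \<open>Infima, the Archimedean property and disjointness\<close>

lemma isGlb_iff:
  "isGlb Z A m \<longleftrightarrow> m \<in> Z \<and> (\<forall>a\<in>A. m \<le> a) \<and> (\<forall>w\<in>Z. (\<forall>a\<in>A. w \<le> a) \<longrightarrow> w \<le> m)"
  by (auto simp: isGlb_def greatestP_def isLb_def setge_def setle_def)

text \<open>Starting from \<open>0 \<le> x\<close>, the step yields by induction that all multiples
  of \<open>c\<close> lie below \<open>x\<close>.\<close>

lemma archimedean_step_imp_zero:
  fixes c x :: "'a::archimedean_vector_lattice"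
  assumes "0 \<le> c" "0 \<le> x"
    and step: "\<And>n::nat. real n *\<^sub>R c \<le> x \<Longrightarrow> real n *\<^sub>R c + c \<le> x"
  shows "c = 0"
proof (rule archimedean[OF \<open>0 \<le> c\<close>])
  fix n :: nat
  show "real n *\<^sub>R c \<le> x"
    by (induction n) (use \<open>0 \<le> x\<close> step in \<open>auto simp: algebra_simps\<close>)
qed

text \<open>The sum \<open>inf a b + inf a c\<close> is the infimum of \<open>a + a\<close>,
  \<open>a + c\<close>, \<open>b + a\<close> and \<open>b + c\<close>, each of which dominates
  \<open>inf a (b + c)\<close>.\<close>

lemma inf_add_eq_zero:
  fixes a b c :: "'a::lattice_ab_group_add"
  assumes "inf a b = 0" "inf a c = 0"
  shows "inf a (b + c) = 0"
proof (rule antisym)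
  have nonneg: "0 \<le> a" "0 \<le> b" "0 \<le> c"
    using assms by (metis inf_le1, metis inf_le2, metis inf_le2)
  then show "0 \<le> inf a (b + c)" by simp
  have "inf a (b + c) \<le> inf a b + inf a c"
    unfolding add_inf_distrib_left add_inf_distrib_right
    using nonneg by (auto intro: le_infI1 le_infI2 add_increasing add_increasing2)
  then show "inf a (b + c) \<le> 0" using assms by simp
qed

lemma inf_scaleR_of_nat_eq_zero:
  fixes a c :: "'a::vector_lattice"
  assumes "inf a c = 0"
  shows "inf a (real n *\<^sub>R c) = 0"
proof (induction n)
  case 0
  have "0 \<le> a" using assms by (metis inf_le1)
  then show ?case by (simp add: inf_absorb2)
next
  case (Suc n)
  then show ?case
    using inf_add_eq_zero[OF assms, of "real n *\<^sub>R c"] by (simp add: algebra_simps)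
qed

text \<open>Since \<open>y + (x - inf x y) = sup x y\<close>, the right side is the infimum of
  \<open>a + (x - inf x y)\<close> and \<open>sup x y\<close>. It serves to change the truncation
  level from \<open>y\<close> to \<open>x\<close>.\<close>

lemma inf_diff_inf_le:
  fixes a x y :: "'a::lattice_ab_group_add"
  shows "inf a x \<le> inf a y + (x - inf x y)"
proof -
  have "0 \<le> x - inf x y" by (simp only: diff_ge_0_iff_ge inf_le1)
  moreover have "inf a x \<le> y + (x - inf x y)"
  proof -
    have "y + (x - inf x y) = sup x y"
      by (metis add.commute add_diff_cancel_left' add_diff_eq add_eq_inf_sup)
    then show ?thesis by (simp add: le_infI2)
  qed
  ultimately show ?thesis
    unfolding add_inf_distrib_right by (auto intro: le_infI1 add_increasing2)
qed

section \<open>Order and uo-convergence through eventual bounds\<close>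

definition eventual_bounds ::
  "'a::vector_lattice set \<Rightarrow> 'i set \<Rightarrow> ('i \<Rightarrow> 'i \<Rightarrow> bool) \<Rightarrow> ('i \<Rightarrow> 'a) \<Rightarrow> 'a set" where
  "eventual_bounds Z I r x = {u \<in> Z. \<exists>i0\<in>I. \<forall>i\<in>I. r i0 i \<longrightarrow> \<bar>x i\<bar> \<le> u}"

lemma eventual_bounds_nonneg:
  assumes "directed_set I r" "u \<in> eventual_bounds Z I r x"
  shows "0 \<le> u"
proof -
  obtain i where "i \<in> I" "\<forall>j\<in>I. r i j \<longrightarrow> \<bar>x j\<bar> \<le> u"
    using assms(2) by (auto simp: eventual_bounds_def)
  moreover have "r i i"
    using assms(1) \<open>i \<in> I\<close> by (auto simp: directed_set_def reflp_on_def)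
  ultimately show ?thesis using abs_ge_zero order_trans by blast
qed

lemma eventual_bounds_inf:
  assumes "sublattice Z" "directed_set I r"
    and u: "u \<in> eventual_bounds Z I r x" and v: "v \<in> eventual_bounds Z I r x"
  shows "inf u v \<in> eventual_bounds Z I r x"
proof -
  obtain i j where ij: "i \<in> I" "\<forall>l\<in>I. r i l \<longrightarrow> \<bar>x l\<bar> \<le> u" "j \<in> I" "\<forall>l\<in>I. r j l \<longrightarrow> \<bar>x l\<bar> \<le> v"
    using u v by (auto simp: eventual_bounds_def)
  obtain k where k: "k \<in> I" "r i k" "r j k"
    using assms(2) ij unfolding directed_set_def by blast
  have "transp_on I r" using assms(2) by (simp add: directed_set_def)
  then have "\<forall>l\<in>I. r k l \<longrightarrow> \<bar>x l\<bar> \<le> inf u v"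
    using ij k by (auto dest: transp_onD)
  moreover have "inf u v \<in> Z"
    using u v assms(1) by (auto simp: eventual_bounds_def sublattice_def)
  ultimately show ?thesis using k by (auto simp: eventual_bounds_def)
qed

text \<open>The values of a dominating net are eventual bounds. Conversely, the eventual bounds are
  closed under \<open>inf\<close>, so indexed by themselves in reverse order they form a dominating
  net.\<close>

lemma order_conv_zero_iff:
  fixes x :: "'i \<Rightarrow> 'a::vector_lattice"
  assumes Z: "sublattice Z" and I: "directed_set I r"
  shows "order_conv Z I r x 0 \<longleftrightarrow>
    eventual_bounds Z I r x \<noteq> {} \<and> isGlb Z (eventual_bounds Z I r x) 0"
    (is "_ \<longleftrightarrow> ?D \<noteq> {} \<and> isGlb Z ?D 0")
proof
  have Z0: "0 \<in> Z" using Z by (simp add: sublattice_def subspace_0)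
  assume "order_conv Z I r x 0"
  then obtain L :: "'a set" and s a where dec: "decreases_to_zero Z L s a"
    and dom: "\<forall>g\<in>L. \<exists>i0\<in>I. \<forall>i\<in>I. r i0 i \<longrightarrow> \<bar>x i\<bar> \<le> a g"
    by (auto simp: order_conv_def)
  then have sub: "a ` L \<subseteq> ?D"
    by (auto simp: eventual_bounds_def decreases_to_zero_def net_in_def)
  have "L \<noteq> {}" "isGlb Z (a ` L) 0"
    using dec by (auto simp: decreases_to_zero_def net_in_def directed_set_def)
  then show "?D \<noteq> {} \<and> isGlb Z ?D 0"
    using sub Z0 eventual_bounds_nonneg[OF I] unfolding isGlb_iff by blast
next
  assume D: "?D \<noteq> {} \<and> isGlb Z ?D 0"
  have "directed_set ?D (\<lambda>u v. v \<le> u)"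
    unfolding directed_set_def
    using D eventual_bounds_inf[OF Z I, of _ x]
    by (auto simp: reflp_on_def transp_on_def intro: inf_le1 inf_le2)
  then have "decreases_to_zero Z ?D (\<lambda>u v. v \<le> u) id"
    using D by (auto simp: decreases_to_zero_def net_in_def eventual_bounds_def)
  then show "order_conv Z I r x 0"
    by (rule order_convI[rotated])
      (use Z in \<open>auto simp: eventual_bounds_def sublattice_def subspace_0\<close>)
qed

text \<open>Nonemptiness is automatic here, because \<open>z\<close> itself bounds the net truncated
  at \<open>z\<close>.\<close>

lemma uo_conv_zero_iff:
  fixes x :: "'i \<Rightarrow> 'a::vector_lattice"
  assumes Z: "sublattice Z" and I: "directed_set I r"
  shows "uo_conv Z I r x 0 \<longleftrightarrow>
    (\<forall>z\<in>Z. 0 \<le> z \<longrightarrow> isGlb Z (eventual_bounds Z I r (\<lambda>i. inf \<bar>x i\<bar> z)) 0)"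
proof -
  have "eventual_bounds Z I r (\<lambda>i. inf \<bar>x i\<bar> z) \<noteq> {}" if "z \<in> Z" "0 \<le> z" for z
    using that I by (auto simp: eventual_bounds_def directed_set_def abs_of_nonneg intro!: exI[of _ z])
  then show ?thesis
    using Z by (auto simp: uo_conv_def order_conv_zero_iff[OF Z I] sublattice_def subspace_0)
qed

text \<open>Any lower bound \<open>w\<close> may be replaced by \<open>sup w 0\<close>, which stays
  in \<open>Z\<close> and below the nonnegative set \<open>D\<close>.\<close>

lemma isGlb_zeroI:
  fixes D :: "'a::vector_lattice set"
  assumes "sublattice Z" "\<And>u. u \<in> D \<Longrightarrow> 0 \<le> u"
    and "\<And>w. w \<in> Z \<Longrightarrow> 0 \<le> w \<Longrightarrow> (\<And>u. u \<in> D \<Longrightarrow> w \<le> u) \<Longrightarrow> w = 0"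
  shows "isGlb Z D 0"
  unfolding isGlb_iff
proof (intro conjI ballI impI)
  show Z0: "0 \<in> Z" using assms(1) by (simp add: sublattice_def subspace_0)
  fix w assume "w \<in> Z" "\<forall>u\<in>D. w \<le> u"
  moreover from this have "sup w 0 \<in> Z" using assms(1) Z0 by (simp add: sublattice_def)
  ultimately have "sup w 0 = 0" using assms(2,3) by simp
  then show "w \<le> 0" by (metis sup_ge1)
qed (use assms(2) in auto)

section \<open>From a regular sublattice to the whole space\<close>

lemma sublattice_UNIV: "sublattice UNIV"
  by (simp add: sublattice_def)

lemma sublattice_abs:
  assumes "sublattice Y" "y \<in> Y"
  shows "\<bar>y\<bar> \<in> Y"
  using assms by (simp add: sublattice_def abs_lattice subspace_neg)

text \<open>Let \<open>c = inf z w\<close>. If \<open>n\<close> copies of \<open>c\<close> lie below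
  \<open>x\<close>, they lie below \<open>inf x (n z)\<close>; adding
  \<open>c \<le> w \<le> x - inf x (n z)\<close> puts one more copy below \<open>x\<close>.\<close>

lemma disjoint_of_le_diff_inf:
  fixes w x z :: "'a::archimedean_vector_lattice"
  assumes "0 \<le> w" "0 \<le> x" "0 \<le> z" and le: "\<And>n::nat. w \<le> x - inf x (real n *\<^sub>R z)"
  shows "inf z w = 0"
proof (rule archimedean_step_imp_zero[of _ x])
  fix n :: nat
  assume "real n *\<^sub>R inf z w \<le> x"
  moreover have "real n *\<^sub>R inf z w \<le> real n *\<^sub>R z" by (simp add: scaleR_left_mono)
  ultimately have "real n *\<^sub>R inf z w \<le> inf x (real n *\<^sub>R z)" by simp
  moreover have "inf z w \<le> x - inf x (real n *\<^sub>R z)" using le by (rule le_infI2)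
  ultimately have "real n *\<^sub>R inf z w + inf z w
      \<le> inf x (real n *\<^sub>R z) + (x - inf x (real n *\<^sub>R z))" by (rule add_mono)
  then show "real n *\<^sub>R inf z w + inf z w \<le> x"
    by (simp only: add.commute[of "inf x _"] diff_add_cancel)
qed (use assms in auto)

lemma regular_imp_uo_conv_UNIV:
  fixes Y :: "'a::archimedean_vector_lattice set"
  assumes Y: "sublattice Y" and reg: "regular Y" and net: "net_in Y I r y"
    and uo: "uo_conv Y I r y 0"
  shows "uo_conv UNIV I r y 0"
proof -
  have I: "directed_set I r" and yY: "\<And>i. i \<in> I \<Longrightarrow> y i \<in> Y"
    using net by (auto simp: net_in_def)
  show ?thesis
    unfolding uo_conv_zero_iff[OF sublattice_UNIV I]
  proof (intro ballI impI)
    fix x :: 'a assume x: "0 \<le> x"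
    show "isGlb UNIV (eventual_bounds UNIV I r (\<lambda>i. inf \<bar>y i\<bar> x)) 0"
    proof (rule isGlb_zeroI[OF sublattice_UNIV eventual_bounds_nonneg[OF I]])
      fix w :: 'a
      assume w: "0 \<le> w"
        and low: "\<And>u. u \<in> eventual_bounds UNIV I r (\<lambda>i. inf \<bar>y i\<bar> x) \<Longrightarrow> w \<le> u"
      \<comment> \<open>Adding \<open>x - inf x z\<close> to an eventual bound of the net truncated
        at \<open>z\<close> gives one at level \<open>x\<close>. By regularity the former bounds
        still have infimum \<open>0\<close> in the whole space.\<close>
      have le: "w \<le> x - inf x z" if z: "z \<in> Y" "0 \<le> z" for z
      proof -
        let ?D = "eventual_bounds Y I r (\<lambda>i. inf \<bar>y i\<bar> z)"
        have "w - (x - inf x z) \<le> u" if u: "u \<in> ?D" for u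
        proof -
          obtain i0 where "i0 \<in> I" "\<forall>i\<in>I. r i0 i \<longrightarrow> inf \<bar>y i\<bar> z \<le> u"
            using u z by (auto simp: eventual_bounds_def abs_of_nonneg)
          moreover have "inf \<bar>y i\<bar> x \<le> u + (x - inf x z)" if "inf \<bar>y i\<bar> z \<le> u" for i
            using inf_diff_inf_le[of "\<bar>y i\<bar>" x z] add_right_mono[OF that] order_trans by blast
          ultimately have "u + (x - inf x z) \<in> eventual_bounds UNIV I r (\<lambda>i. inf \<bar>y i\<bar> x)"
            using x by (auto simp: eventual_bounds_def abs_of_nonneg)
          from low[OF this] show ?thesis by (simp add: algebra_simps)
        qed
        moreover have "isGlb UNIV ?D 0"
        proof -
          have "isGlb Y ?D 0" using uo z uo_conv_zero_iff[OF Y I] by blast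
          moreover have "z \<in> ?D"
            using z I by (auto simp: eventual_bounds_def abs_of_nonneg directed_set_def)
          moreover have "?D \<subseteq> Y" by (auto simp: eventual_bounds_def)
          ultimately show ?thesis using reg unfolding regular_def by blast
        qed
        ultimately have "w - (x - inf x z) \<le> 0" unfolding isGlb_iff by blast
        then show ?thesis by simp
      qed
      have disj: "inf \<bar>y i\<bar> w = 0" if "i \<in> I" for i
      proof (rule disjoint_of_le_diff_inf[OF w x])
        have "\<bar>y i\<bar> \<in> Y" using that Y yY sublattice_abs by blast
        then show "w \<le> x - inf x (real n *\<^sub>R \<bar>y i\<bar>)" for n :: nat
          using Y by (intro le) (auto simp: sublattice_def subspace_scale scaleR_nonneg_nonneg)
      qed simp
      show "w = 0"
      proof (rule archimedean_step_imp_zero[OF w x])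
        fix n :: nat
        assume n: "real n *\<^sub>R w \<le> x"
        have "inf \<bar>y i\<bar> x \<le> x - real n *\<^sub>R w" if "i \<in> I" for i
        proof -
          let ?a = "inf \<bar>y i\<bar> x" and ?b = "real n *\<^sub>R w"
          \<comment> \<open>Disjointness turns the sum \<open>?a + ?b\<close> into a supremum of two
            elements below \<open>x\<close>.\<close>
          have "inf ?a ?b = inf x (inf \<bar>y i\<bar> ?b)" by (simp add: ac_simps)
          also have "\<dots> = 0"
            using x inf_scaleR_of_nat_eq_zero[OF disj[OF that]] by (simp add: inf_absorb2)
          finally have "?a + ?b = sup ?a ?b" using add_eq_inf_sup[of ?a ?b] by simp
          also have "\<dots> \<le> x" using n by simp
          finally show ?thesis by (simp add: algebra_simps)
        qed
        then have "x - real n *\<^sub>R w \<in> eventual_bounds UNIV I r (\<lambda>i. inf \<bar>y i\<bar> x)"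
          using x I by (auto simp: eventual_bounds_def abs_of_nonneg directed_set_def)
        from low[OF this] show "real n *\<^sub>R w + w \<le> x" by (simp add: algebra_simps)
      qed
    qed
  qed
qed

section \<open>From the whole space back to a regular sublattice\<close>

lemma isGlb_upper_bounds_diff:
  fixes Y :: "'a::archimedean_vector_lattice set"
  assumes Y: "sublattice Y" and A: "A \<noteq> {}" "A \<subseteq> Y"
    and z: "z \<in> Y" "\<And>a. a \<in> A \<Longrightarrow> a \<le> z"
  shows "isGlb Y {u - a |u a. a \<in> A \<and> u \<in> Y \<and> (\<forall>b\<in>A. b \<le> u)} 0"
proof (rule isGlb_zeroI[OF Y])
  fix c
  assume c: "c \<in> Y" "0 \<le> c"
    and "\<And>v. v \<in> {u - a |u a. a \<in> A \<and> u \<in> Y \<and> (\<forall>b\<in>A. b \<le> u)} \<Longrightarrow> c \<le> v"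
  then have low: "c \<le> u - a" if "a \<in> A" "u \<in> Y" "\<forall>b\<in>A. b \<le> u" for u a using that by blast
  obtain a where a: "a \<in> A" using A by blast
  show "c = 0"
  proof (rule archimedean)
    show "0 \<le> c" by fact
    fix n :: nat
    \<comment> \<open>Because \<open>c \<le> u - b\<close> for every upper bound \<open>u\<close> in
      \<open>Y\<close>, subtracting \<open>c\<close> leaves an upper bound in \<open>Y\<close>, so
      the subtraction can be repeated from \<open>z\<close> on.\<close>
    have "\<forall>b\<in>A. b \<le> z - real n *\<^sub>R c"
    proof (induction n)
      case (Suc n)
      have "z - real n *\<^sub>R c \<in> Y"
        using Y z c by (simp add: sublattice_def subspace_diff subspace_scale)
      with Suc low[of _ "z - real n *\<^sub>R c"] show ?case by (fastforce simp: algebra_simps)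
    qed (use z in simp)
    then show "real n *\<^sub>R c \<le> z - a" using a by (auto simp: algebra_simps)
  qed
qed auto

lemma regular_imp_uo_conv_sublattice:
  fixes Y :: "'a::archimedean_vector_lattice set"
  assumes Y: "sublattice Y" and reg: "regular Y" and net: "net_in Y I r y"
    and uo: "uo_conv UNIV I r y 0"
  shows "uo_conv Y I r y 0"
proof -
  have I: "directed_set I r" and yY: "\<And>i. i \<in> I \<Longrightarrow> y i \<in> Y"
    using net by (auto simp: net_in_def)
  show ?thesis
    unfolding uo_conv_zero_iff[OF Y I]
  proof (intro ballI impI)
    fix z assume z: "z \<in> Y" "0 \<le> z"
    show "isGlb Y (eventual_bounds Y I r (\<lambda>i. inf \<bar>y i\<bar> z)) 0"
    proof (rule isGlb_zeroI[OF Y eventual_bounds_nonneg[OF I]])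
      fix w
      assume w: "0 \<le> w"
        and low: "\<And>u. u \<in> eventual_bounds Y I r (\<lambda>i. inf \<bar>y i\<bar> z) \<Longrightarrow> w \<le> u"
      \<comment> \<open>The assumption controls only the bounds taken in the whole space, so
        \<open>w\<close> must be moved below those.\<close>
      have "w \<le> v" if v: "v \<in> eventual_bounds UNIV I r (\<lambda>i. inf \<bar>y i\<bar> z)" for v
      proof -
        obtain i0 where i0: "i0 \<in> I" "\<forall>i\<in>I. r i0 i \<longrightarrow> inf \<bar>y i\<bar> z \<le> v"
          using v z by (auto simp: eventual_bounds_def abs_of_nonneg)
        define A where "A = {inf \<bar>y i\<bar> z |i. i \<in> I \<and> r i0 i}"
        define V where "V = {u - a |u a. a \<in> A \<and> u \<in> Y \<and> (\<forall>b\<in>A. b \<le> u)}"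
        have "r i0 i0" using I i0 by (auto simp: directed_set_def reflp_on_def)
        then have A_ne: "A \<noteq> {}" using i0 by (auto simp: A_def)
        have AY: "A \<subseteq> Y"
          using Y yY z sublattice_abs[OF Y] by (auto simp: A_def sublattice_def)
        have Az: "a \<le> z" if "a \<in> A" for a using that by (auto simp: A_def)
        have "isGlb Y V 0"
          unfolding V_def using isGlb_upper_bounds_diff[OF Y A_ne AY z(1) Az] .
        moreover have "V \<noteq> {}" using A_ne Az z(1) unfolding V_def by blast
        moreover have "V \<subseteq> Y" using AY Y by (auto simp: V_def sublattice_def subspace_diff)
        ultimately have glb: "isGlb UNIV V 0" using reg unfolding regular_def by blast
        have "w - v \<le> u - a" if "a \<in> A" "u \<in> Y" "\<forall>b\<in>A. b \<le> u" for u a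
        proof -
          have "u \<in> eventual_bounds Y I r (\<lambda>i. inf \<bar>y i\<bar> z)"
            using that i0 z by (auto simp: eventual_bounds_def abs_of_nonneg A_def)
          then have "w \<le> u" by (rule low)
          moreover have "a \<le> v" using that i0 by (auto simp: A_def)
          ultimately show ?thesis by (rule diff_mono)
        qed
        then have "w - v \<le> 0" using glb unfolding isGlb_iff V_def by blast
        then show ?thesis by simp
      qed
      moreover have "isGlb UNIV (eventual_bounds UNIV I r (\<lambda>i. inf \<bar>y i\<bar> z)) 0"
        using uo z uo_conv_zero_iff[OF sublattice_UNIV I] by blast
      ultimately have "w \<le> 0" unfolding isGlb_iff by blast
      with w show "w = 0" by simp
    qed
  qed
qed

section \<open>Regularity from uo-convergence\<close>

lemma regular_if_uo_conv_UNIV: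
  fixes Y :: "'a::vector_lattice set" and h :: "'a \<Rightarrow> 'k"
  assumes Y: "sublattice Y" and h: "inj h"
    and imp: "\<And>(I :: 'k set) r y. net_in Y I r y \<Longrightarrow> uo_conv Y I r y 0 \<Longrightarrow> uo_conv UNIV I r y 0"
  shows "regular Y"
  unfolding regular_def
proof (intro allI impI, elim conjE)
  fix A m assume A: "A \<noteq> {}" "A \<subseteq> Y" and m: "isGlb Y A m"
  \<comment> \<open>\<open>A\<close> need not be directed downwards. \<open>B\<close> contains
    \<open>A\<close> and is closed under \<open>inf\<close>, yet every lower bound of
    \<open>A\<close> in the whole space is still below it.\<close>
  define B where "B = {b \<in> Y. \<forall>w. (\<forall>a\<in>A. w \<le> a) \<longrightarrow> w \<le> b}"
  let ?r = "\<lambda>u v :: 'a. v \<le> u" and ?y = "\<lambda>b. b - m"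
  have mY: "m \<in> Y" using m by (simp add: isGlb_iff)
  have AB: "A \<subseteq> B" using A by (auto simp: B_def)
  have mB: "m \<le> b" if "b \<in> B" for b using that m by (auto simp: B_def isGlb_iff)
  have "inf b c \<in> B" if "b \<in> B" "c \<in> B" for b c
    using that Y by (auto simp: B_def sublattice_def)
  then have dir: "directed_set B ?r"
    using A AB by (auto simp: directed_set_def reflp_on_def transp_on_def intro: inf_le1 inf_le2)
  have net: "net_in Y B ?r ?y"
    using dir Y mY by (auto simp: net_in_def B_def sublattice_def subspace_diff)
  have "uo_conv Y B ?r ?y 0"
    unfolding uo_conv_zero_iff[OF Y dir]
  proof (intro ballI impI)
    fix z assume z: "z \<in> Y" "0 \<le> z"
    show "isGlb Y (eventual_bounds Y B ?r (\<lambda>b. inf \<bar>b - m\<bar> z)) 0"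
    proof (rule isGlb_zeroI[OF Y eventual_bounds_nonneg[OF dir]])
      fix w
      assume w: "w \<in> Y" "0 \<le> w"
        and low: "\<And>u. u \<in> eventual_bounds Y B ?r (\<lambda>b. inf \<bar>b - m\<bar> z) \<Longrightarrow> w \<le> u"
      have "w + m \<le> b" if "b \<in> B" for b
      proof -
        \<comment> \<open>The net decreases, so its value at \<open>b\<close> bounds everything from
          \<open>b\<close> on.\<close>
        have "b - m \<in> eventual_bounds Y B ?r (\<lambda>b. inf \<bar>b - m\<bar> z)"
          using that net mB z
          by (auto simp: eventual_bounds_def abs_of_nonneg net_in_def intro!: bexI[of _ b] le_infI1)
        then show ?thesis using low[of "b - m"] by (simp add: algebra_simps)
      qed
      moreover have "w + m \<in> Y" using Y w mY by (simp add: sublattice_def subspace_add)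
      ultimately have "w + m \<le> m" using m AB unfolding isGlb_iff by blast
      with w show "w = 0" by simp
    qed
  qed
  \<comment> \<open>The hypothesis concerns index sets in \<open>'k\<close>, so the net is
    relabelled along \<open>h\<close>.\<close>
  moreover have hB: "inj_on h B" using h by (rule inj_on_subset) simp
  ultimately have uo: "uo_conv UNIV B ?r ?y 0"
    using imp[of "h ` B" "transport h B ?r" "?y \<circ> inv_into B h"] net
    unfolding net_in_reindex[OF hB] uo_conv_reindex[OF hB] by blast
  obtain b0 where b0: "b0 \<in> B" using A AB by blast
  \<comment> \<open>Truncation at \<open>b0 - m\<close> loses nothing: a lower bound
    \<open>w\<close> of \<open>A\<close> has \<open>w - m\<close> below both \<open>b - m\<close>
    and \<open>b0 - m\<close>.\<close>
  let ?D = "eventual_bounds UNIV B ?r (\<lambda>b. inf \<bar>b - m\<bar> (b0 - m))"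
  have glb: "isGlb UNIV ?D 0"
  proof -
    have "0 \<le> b0 - m" using mB[OF b0] by simp
    then show ?thesis using uo unfolding uo_conv_zero_iff[OF sublattice_UNIV dir] by blast
  qed
  have "w \<le> m" if w: "\<forall>a\<in>A. w \<le> a" for w
  proof -
    have "w - m \<le> u" if u: "u \<in> ?D" for u
    proof -
      obtain b where b: "b \<in> B" "inf (b - m) (b0 - m) \<le> u"
        using u mB mB[OF b0] by (force simp: eventual_bounds_def abs_of_nonneg)
      have "w \<le> b" "w \<le> b0" using b b0 w by (auto simp: B_def)
      then have "w - m \<le> inf (b - m) (b0 - m)" by (simp add: diff_right_mono)
      also note b(2)
      finally show ?thesis .
    qed
    then have "w - m \<le> 0" using glb unfolding isGlb_iff by blast
    then show ?thesis by simp
  qed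
  then show "isGlb UNIV A m" using m unfolding isGlb_iff by blast
qed

(* X is the type 'a. The index type 'i is free and every index set of type 'i set relabels along Inr
   to one of type ('a + 'i) set. The summand 'a only guarantees that there are enough nets, whatever
   'i is: conditions (2) and (3) hold trivially for nets with, say, a one-element index type. *)
theorem theorem3p2:
  fixes Y :: "'a::archimedean_vector_lattice set"
  assumes "sublattice Y"
  shows
    "(regular Y \<longleftrightarrow>
       (\<forall>(I :: ('a + 'i) set) r y. net_in Y I r y \<longrightarrow>
          uo_conv Y I r y 0 \<longrightarrow> uo_conv UNIV I r y 0)) \<and>
     (regular Y \<longleftrightarrow>
       (\<forall>(I :: ('a + 'i) set) r y. net_in Y I r y \<longrightarrow>
          (uo_conv Y I r y 0 \<longleftrightarrow> uo_conv UNIV I r y 0)))"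
proof -
  let ?two = "\<forall>(I :: ('a + 'i) set) r y. net_in Y I r y \<longrightarrow>
    uo_conv Y I r y 0 \<longrightarrow> uo_conv UNIV I r y 0"
  have "?two \<Longrightarrow> regular Y"
    by (rule regular_if_uo_conv_UNIV[OF assms, of "Inl :: 'a \<Rightarrow> 'a + 'i"]) auto
  then show ?thesis
    using regular_imp_uo_conv_UNIV[OF assms] regular_imp_uo_conv_sublattice[OF assms] by blast
qed

end
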